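(* Let $s$ and $d$ be coprime positive integers. There is a bijection between the set $\mathcal{DD}_{(s,s+d,s+2d)}$ of doubled distinct $(s,s+d,s+2d)$-core partitions and (a) $\mathcal{F}\left(\frac{s+d+1}{2},-\frac{d}{2} \,;\, \{U\},\{D\}\right)$ if $s$ is odd and $d$ is even; (b) $\mathcal{F}\left(\frac{s+d}{2},-\frac{d+1}{2} \,;\, \{U\},\emptyset\right)$ if both $s$ and $d$ are odd; (c) $\mathcal{F}\left(\frac{s+d-1}{2},-\frac{d+1}{2} \,;\, \{U\},\emptyset\right)$ if $s$ is even and $d$ is odd.
   Context: A strict partition $\lambda=(\lambda_1>\lambda_2>\cdots>\lambda_\ell)$ is a finite (possibly empty) strictly decreasing sequence of positive integers. For a strict partition $\lambda$, the doubled distinct partition $\lambda\lambda$ is the ordinary partition with Frobenius symbol $\begin{pmatrix}\lambda_1&\cdots&\lambda_\ell\\ \lambda_1-1&\cdots&\lambda_\ell-1\end{pmatrix}$ (the $i$th diagonal box has arm length $\lambda_i$ and leg length $\lambda_i-1$). It is a doubled distinct $s$-core if no hook length of its Young diagram is divisible by $s$. $\mathcal{DD}_{(s_1,s_2,s_3)}$ is the set of doubled distinct partitions $\lambda\lambda$ that are doubled distinct $s_k$-cores for all $k=1,2,3$ (the empty partition included). A free Motzkin path of type $(m,n)$ is a path from $(0,0)$ to $(m,n)$ consisting of steps $U=(1,1)$, $F=(1,0)$, $D=(1,-1)$. For sets $A,B$ of finite sequences of steps, $\mathcal{F}(m,n\,;\,A,B)$ is the set of free Motzkin paths of type $(m,n)$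 that do not start with any sequence in $A$ and do not end with any sequence in $B$. *)

theory Defs
  imports Main "HOL-Library.Sublist"
begin

text \<open>Rows and columns of Young diagrams, and diagonal boxes, are numbered from \<open>0\<close>
  (English convention: row \<open>i\<close> has \<open>\<mu> ! i\<close> boxes).\<close>

definition is_partition :: "nat list \<Rightarrow> bool" where
  "is_partition \<mu> \<longleftrightarrow> sorted_wrt (\<ge>) \<mu> \<and> 0 \<notin> set \<mu>"

definition is_strict_partition :: "nat list \<Rightarrow> bool" where
  "is_strict_partition \<nu> \<longleftrightarrow> sorted_wrt (>) \<nu> \<and> 0 \<notin> set \<nu>"

definition young_diagram :: "nat list \<Rightarrow> (nat \<times> nat) set" where
  "young_diagram \<mu> = {(i, j). i < length \<mu> \<and> j < \<mu> ! i}"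

definition arm_length :: "nat list \<Rightarrow> nat \<Rightarrow> nat \<Rightarrow> nat" where
  "arm_length \<mu> i j = card {j'. j < j' \<and> (i, j') \<in> young_diagram \<mu>}"

definition leg_length :: "nat list \<Rightarrow> nat \<Rightarrow> nat \<Rightarrow> nat" where
  "leg_length \<mu> i j = card {i'. i < i' \<and> (i', j) \<in> young_diagram \<mu>}"

definition hook_length :: "nat list \<Rightarrow> nat \<Rightarrow> nat \<Rightarrow> nat" where
  "hook_length \<mu> i j = arm_length \<mu> i j + leg_length \<mu> i j + 1"

definition has_frobenius_symbol :: "nat list \<Rightarrow> nat list \<Rightarrow> nat list \<Rightarrow> bool" where
  "has_frobenius_symbol \<mu> as bs \<longleftrightarrow>
     length as = length bs \<and>
     {i. (i, i) \<in> young_diagram \<mu>} = {..<length as} \<and>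
     (\<forall>i<length as. arm_length \<mu> i i = as ! i \<and> leg_length \<mu> i i = bs ! i)"

definition is_doubled_distinct_of :: "nat list \<Rightarrow> nat list \<Rightarrow> bool" where
  "is_doubled_distinct_of \<mu> \<nu> \<longleftrightarrow>
     is_partition \<mu> \<and> has_frobenius_symbol \<mu> \<nu> (map (\<lambda>x. x - 1) \<nu>)"

definition is_core :: "nat \<Rightarrow> nat list \<Rightarrow> bool" where
  "is_core s \<mu> \<longleftrightarrow> (\<forall>(i, j) \<in> young_diagram \<mu>. \<not> s dvd hook_length \<mu> i j)"

definition DD_cores :: "nat \<Rightarrow> nat \<Rightarrow> nat \<Rightarrow> nat list set" where
  "DD_cores s1 s2 s3 =
     {\<mu>. (\<exists>\<nu>. is_strict_partition \<nu> \<and> is_doubled_distinct_of \<mu> \<nu>) \<and>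
         is_core s1 \<mu> \<and> is_core s2 \<mu> \<and> is_core s3 \<mu>}"

datatype step = Up | Flat | Down

fun rise :: "step \<Rightarrow> int" where
  "rise Up = 1"
| "rise Flat = 0"
| "rise Down = -1"

text \<open>A path starting at the origin is identified with its list of steps. Every step advances
  the first coordinate by \<open>1\<close>, so the path ends at the point given by its length and its
  total rise.\<close>

definition free_motzkin_paths :: "nat \<Rightarrow> int \<Rightarrow> step list set" where
  "free_motzkin_paths m n = {p. length p = m \<and> (\<Sum>x\<leftarrow>p. rise x) = n}"

definition restricted_motzkin_paths ::
    "nat \<Rightarrow> int \<Rightarrow> step list set \<Rightarrow> step list set \<Rightarrow> step list set" where
  "restricted_motzkin_paths m n A B =
     {p \<in> free_motzkin_paths m n. (\<forall>a\<in>A. \<not> prefix a p) \<and> (\<forall>b\<in>B. \<not> suffix b p)}"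

end

theory Submission
  imports Defs
begin

text \<open>
  A partition \<open>\<mu>\<close> is encoded by its set of beads \<open>\<mu>\<^sub>i - i - 1\<close> on the integer line, where \<open>i\<close>
  runs over all row indices and \<open>\<mu>\<^sub>i = 0\<close> past the last row. Hooks of length \<open>s\<close> are pairs of a
  bead and a non-bead lying \<open>s\<close> below it, so \<open>\<mu>\<close> is an \<open>s\<close>-core exactly if its bead set is closed
  under subtraction of \<open>s\<close> (\<open>is_core_iff_down_closed\<close>). The Frobenius symbol lists the beads
  \<open>\<ge> 0\<close> and the non-beads \<open>< 0\<close>; the doubled distinct condition thus says that \<open>0\<close> is not a
  bead and that exactly one of \<open>x\<close> and \<open>- x\<close> is a bead for every \<open>x \<noteq> 0\<close>
  (\<open>doubled_distinct_iff_skew\<close>). Hence the cores correspond to the skew sets of integers that are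
  closed under subtraction of \<open>s\<close>, \<open>s + d\<close> and \<open>s + 2d\<close> (\<open>bij_betw_beads\<close>).

  Put \<open>t = s + d\<close>, which is coprime to \<open>d\<close>, and write integers as \<open>x = i d + j t\<close>; the pair
  \<open>(i, j)\<close> is unique up to adding multiples of \<open>(t, - d)\<close>. The three subtractions move \<open>(i, j)\<close> to
  \<open>(i + 1, j - 1)\<close>, \<open>(i, j - 1)\<close> and \<open>(i - 1, j - 1)\<close>. So the set is the region strictly below the
  graph of a function \<open>h\<close> on the integers, closure means \<open>\<bar>h (i + 1) - h i\<bar> \<le> 1\<close>, that is,
  \<open>h\<close> is a bi-infinite Motzkin path, and uniqueness up to \<open>(t, - d)\<close> means \<open>h (i + t) = h i - d\<close>.
  The skew condition becomes \<open>h 0 = 0\<close> and \<open>h (- i) = 1 - h i\<close> for \<open>i\<close> not divisible by \<open>t\<close>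
  (\<open>bij_betw_region\<close>).

  By these symmetries \<open>h\<close> is determined by its values on \<open>0, \<dots>, t div 2\<close>. The reflection
  \<open>h (- 1) = 1 - h 1\<close> forces \<open>h 1 \<in> {0, 1}\<close>. Lowering \<open>h\<close> by \<open>1\<close> at the positive
  arguments therefore turns it into a path whose first step is not \<open>Up\<close>. At the
  other end, the reflection \<open>h (t - i) = 1 - d - h i\<close> must agree with the path at the middle, which
  restricts the total rise \<open>n\<close> to \<open>\<bar>2 n + d + 1\<bar> \<le> 1\<close>; nothing else is required
  (\<open>bij_betw_unfold_path\<close>). If \<open>d\<close> is odd this leaves the single value \<open>n = - (d + 1) / 2\<close>. If
  \<open>d\<close> is even it leaves \<open>- d / 2\<close> and \<open>- d / 2 - 1\<close>; appending a \<open>Flat\<close> or an \<open>Up\<close> step makes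
  both end at \<open>- d / 2\<close>, and the result is characterised by not ending in \<open>Down\<close>.
\<close>

section \<open>Beads and gaps of a partition\<close>

definition row :: "nat list \<Rightarrow> nat \<Rightarrow> nat" where
  "row \<mu> i = (if i < length \<mu> then \<mu> ! i else 0)"

text \<open>For a partition this is the length of column \<open>j\<close>; the least row index that does not reach the
  column is easier to work with than the cardinality of the column.\<close>
definition col :: "nat list \<Rightarrow> nat \<Rightarrow> nat" where
  "col \<mu> j = (LEAST i. row \<mu> i \<le> j)"

text \<open>The boundary of the diagram is a lattice path with one vertical step at the end of each row and
  one horizontal step at the foot of each column. When its steps are numbered consecutively, with the
  main diagonal separating \<open>- 1\<close> from \<open>0\<close>, the vertical ones get the numbers \<open>bead \<mu> i\<close> and the horizontal
  ones the numbers \<open>gap \<mu> j\<close>.\<close>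
definition bead :: "nat list \<Rightarrow> nat \<Rightarrow> int" where
  "bead \<mu> i = int (row \<mu> i) - int i - 1"

definition gap :: "nat list \<Rightarrow> nat \<Rightarrow> int" where
  "gap \<mu> j = int j - int (col \<mu> j)"

abbreviation beads :: "nat list \<Rightarrow> int set" where
  "beads \<mu> \<equiv> range (bead \<mu>)"

lemma young_diagram_iff: "(i, j) \<in> young_diagram \<mu> \<longleftrightarrow> j < row \<mu> i"
  by (auto simp: young_diagram_def row_def)

lemma row_antimono:
  assumes "is_partition \<mu>" "i \<le> j"
  shows "row \<mu> j \<le> row \<mu> i"
  using assms by (cases "i = j") (auto simp: row_def is_partition_def sorted_wrt_iff_nth_less)

lemma less_col_iff:
  assumes "is_partition \<mu>"
  shows "i < col \<mu> j \<longleftrightarrow> j < row \<mu> i"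
proof
  assume "i < col \<mu> j"
  then show "j < row \<mu> i"
    unfolding col_def by (meson not_less_Least not_less)
next
  assume less: "j < row \<mu> i"
  have "row \<mu> (length \<mu>) \<le> j"
    by (simp add: row_def)
  then have "row \<mu> (col \<mu> j) \<le> j"
    unfolding col_def by (rule LeastI)
  with less row_antimono[OF assms, of "col \<mu> j" i] show "i < col \<mu> j"
    by (meson leD le_trans not_le)
qed

lemma arm_length_eq: "arm_length \<mu> i j = row \<mu> i - j - 1"
proof -
  have "{j'. j < j' \<and> (i, j') \<in> young_diagram \<mu>} = {j<..<row \<mu> i}"
    by (auto simp: young_diagram_iff)
  then show ?thesis by (simp add: arm_length_def)
qed

lemma leg_length_eq:
  assumes "is_partition \<mu>"
  shows "leg_length \<mu> i j = col \<mu> j - i - 1"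
proof -
  have "{i'. i < i' \<and> (i', j) \<in> young_diagram \<mu>} = {i<..<col \<mu> j}"
    using less_col_iff[OF assms] by (auto simp: young_diagram_iff)
  then show ?thesis by (simp add: leg_length_def)
qed

lemma hook_length_eq:
  assumes "is_partition \<mu>" "j < row \<mu> i"
  shows "int (hook_length \<mu> i j) = bead \<mu> i - gap \<mu> j"
proof -
  have "i < col \<mu> j" using less_col_iff assms by blast
  with assms show ?thesis
    by (simp add: hook_length_def arm_length_eq leg_length_eq bead_def gap_def)
qed

lemma bead_strict_antimono:
  assumes "is_partition \<mu>" "i < j"
  shows "bead \<mu> j < bead \<mu> i"
  using row_antimono[OF assms(1), of i j] assms(2) by (simp add: bead_def)

lemma gap_strict_mono:
  assumes "is_partition \<mu>" "i < j"
  shows "gap \<mu> i < gap \<mu> j"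
proof -
  have "col \<mu> j \<le> col \<mu> i"
    using less_col_iff[OF assms(1), of "col \<mu> i" j] less_col_iff[OF assms(1), of "col \<mu> i" i] assms(2)
    by linarith
  with assms(2) show ?thesis by (simp add: gap_def)
qed

text \<open>Every step of the boundary is either vertical or horizontal. To locate a non-bead \<open>y\<close> as a
  gap, let \<open>k\<close> be the number of beads above it: the column \<open>y + k\<close> then has length \<open>k\<close>.\<close>
lemma beads_compl_eq_gaps:
  assumes "is_partition \<mu>"
  shows "- beads \<mu> = range (gap \<mu>)"
proof (intro equalityI subsetI)
  fix y assume "y \<in> - beads \<mu>"
  then have not_bead: "bead \<mu> i \<noteq> y" for i by auto
  define k where "k = (LEAST i. bead \<mu> i < y)"
  define m where "m = length \<mu> + nat \<bar>y\<bar>"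
  have "bead \<mu> m < y"
    by (simp add: bead_def row_def m_def)
  then have below: "bead \<mu> k < y"
    unfolding k_def by (rule LeastI)
  have above: "y < bead \<mu> r" if "r < k" for r
    using not_less_Least[of r "\<lambda>i. bead \<mu> i < y"] not_bead[of r] that unfolding k_def by linarith
  define j where "j = nat (y + int k)"
  have nonneg: "0 \<le> y + int k"
    using below by (simp add: bead_def)
  have "j < row \<mu> r \<longleftrightarrow> r < k" for r
  proof
    assume "r < k"
    then have "y < bead \<mu> (k - 1)" "row \<mu> (k - 1) \<le> row \<mu> r"
      by (auto intro!: above row_antimono assms)
    with nonneg \<open>r < k\<close> show "j < row \<mu> r"
      by (simp add: bead_def j_def)
  next
    assume "j < row \<mu> r"
    moreover have "row \<mu> k \<le> j"
      using below by (simp add: bead_def j_def)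
    ultimately show "r < k"
      using row_antimono[OF assms, of k r] by linarith
  qed
  then have "col \<mu> j = k"
    using less_col_iff[OF assms, of _ j] by (metis linorder_neqE_nat less_irrefl)
  then have "y = gap \<mu> j"
    using nonneg by (simp add: gap_def j_def)
  then show "y \<in> range (gap \<mu>)" by simp
next
  fix y assume "y \<in> range (gap \<mu>)"
  then obtain j where y: "y = gap \<mu> j" by blast
  have "bead \<mu> i \<noteq> gap \<mu> j" for i
    using less_col_iff[OF assms, of i j] by (cases "i < col \<mu> j") (auto simp: bead_def gap_def)
  then show "y \<in> - beads \<mu>" using y by (metis ComplI rangeE)
qed

section \<open>Cores and doubled distinct partitions in terms of beads\<close>

definition down_closed :: "nat \<Rightarrow> int set \<Rightarrow> bool" where
  "down_closed s X \<longleftrightarrow> (\<forall>x\<in>X. x - int s \<in> X)"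

lemma down_closed_multiple:
  assumes "down_closed s X" "x \<in> X"
  shows "x - int n * int s \<in> X"
proof (induction n)
  case (Suc n)
  then have "x - int n * int s - int s \<in> X"
    using assms(1) by (simp add: down_closed_def)
  then show ?case by (simp add: algebra_simps)
qed (simp add: assms)

text \<open>A bead with a gap \<open>s\<close> below it is a hook of length \<open>s\<close>. Conversely a hook of length \<open>n s\<close> leads
  from a bead down to a gap in \<open>n\<close> jumps of size \<open>s\<close>, so a closed bead set excludes all multiples of
  \<open>s\<close> and not only \<open>s\<close> itself.\<close>
lemma is_core_iff_down_closed:
  assumes "is_partition \<mu>" "s > 0"
  shows "is_core s \<mu> \<longleftrightarrow> down_closed s (beads \<mu>)"
proof
  assume core: "is_core s \<mu>"
  show "down_closed s (beads \<mu>)"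
    unfolding down_closed_def
  proof (intro ballI, rule ccontr)
    fix x assume "x \<in> beads \<mu>" "x - int s \<notin> beads \<mu>"
    then obtain i j where x: "x = bead \<mu> i" and y: "x - int s = gap \<mu> j"
      using beads_compl_eq_gaps[OF assms(1)] by blast
    have "gap \<mu> j < bead \<mu> i" using x y assms(2) by linarith
    then have box: "j < row \<mu> i"
      using less_col_iff[OF assms(1), of i j] by (cases "i < col \<mu> j") (auto simp: bead_def gap_def)
    then have "hook_length \<mu> i j = s"
      using hook_length_eq[OF assms(1), of j i] x y by simp
    moreover have "\<not> s dvd hook_length \<mu> i j"
      using core box unfolding is_core_def by (auto simp flip: young_diagram_iff)
    ultimately show False by simp
  qed
next
  assume closed: "down_closed s (beads \<mu>)"
  show "is_core s \<mu>"
    unfolding is_core_def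
  proof clarify
    fix i j assume "(i, j) \<in> young_diagram \<mu>" "s dvd hook_length \<mu> i j"
    then obtain n where "hook_length \<mu> i j = s * n" and "j < row \<mu> i"
      by (auto simp: young_diagram_iff)
    then have "gap \<mu> j = bead \<mu> i - int n * int s"
      using hook_length_eq[OF assms(1), of j i] by (simp add: algebra_simps)
    then have "gap \<mu> j \<in> beads \<mu>"
      using down_closed_multiple[OF closed] by simp
    then show False
      using beads_compl_eq_gaps[OF assms(1)] by blast
  qed
qed

definition skew :: "int set \<Rightarrow> bool" where
  "skew X \<longleftrightarrow> 0 \<notin> X \<and> (\<forall>x. x \<noteq> 0 \<longrightarrow> (x \<in> X \<longleftrightarrow> - x \<notin> X))"

lemma skew_zero: "skew X \<Longrightarrow> 0 \<notin> X"
  by (simp add: skew_def)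

lemma skew_uminus: "skew X \<Longrightarrow> x \<noteq> 0 \<Longrightarrow> - x \<in> X \<longleftrightarrow> x \<notin> X"
  unfolding skew_def by blast

lemma strictly_decreasing_lists_eqI:
  fixes xs ys :: "'a :: linorder list"
  assumes "sorted_wrt (>) xs" "sorted_wrt (>) ys" "set xs = set ys"
  shows "xs = ys"
proof -
  have "rev xs = rev ys"
    by (rule strict_sorted_equal) (use assms in \<open>auto simp: sorted_wrt_rev\<close>)
  then show ?thesis by simp
qed

lemma diagonal_eq_lessThan:
  assumes "is_partition \<mu>"
  obtains n where "\<And>i. i < row \<mu> i \<longleftrightarrow> i < n" "\<And>i. i < col \<mu> i \<longleftrightarrow> i < n"
proof -
  define n where "n = (LEAST i. row \<mu> i \<le> i)"
  have "row \<mu> (length \<mu>) \<le> length \<mu>" by (simp add: row_def)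
  then have n: "row \<mu> n \<le> n" unfolding n_def by (rule LeastI)
  have "i < row \<mu> i \<longleftrightarrow> i < n" for i
    using not_less_Least[of i "\<lambda>i. row \<mu> i \<le> i"] row_antimono[OF assms, of n i] n
    unfolding n_def[symmetric] by linarith
  then show ?thesis using that less_col_iff[OF assms] by blast
qed

text \<open>The diagonal box in row \<open>i\<close> has arm \<open>bead \<mu> i\<close> and leg \<open>- gap \<mu> i - 1\<close>. Legs that are one
  less than the arms therefore mean \<open>gap \<mu> i = - bead \<mu> i\<close> on the diagonal, where the beads are the
  non-negative ones and the gaps the negative ones. For the converse only the sets
  of beads and negated gaps are known to agree; both sequences are strictly decreasing, so they agree
  entry by entry.\<close>
lemma doubled_distinct_iff_skew:
  assumes part: "is_partition \<mu>"
  shows "(\<exists>\<nu>. is_strict_partition \<nu> \<and> is_doubled_distinct_of \<mu> \<nu>) \<longleftrightarrow> skew (beads \<mu>)"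
proof -
  obtain n where row_n: "\<And>i. i < row \<mu> i \<longleftrightarrow> i < n" and col_n: "\<And>i. i < col \<mu> i \<longleftrightarrow> i < n"
    using diagonal_eq_lessThan[OF part] by blast
  have diag: "{i. (i, i) \<in> young_diagram \<mu>} = {..<n}"
    using row_n by (auto simp: young_diagram_iff)
  have arm: "int (arm_length \<mu> i i) = bead \<mu> i" if "i < n" for i
    using row_n[of i] that by (simp add: arm_length_eq bead_def)
  have leg: "int (leg_length \<mu> i i) = - gap \<mu> i - 1" if "i < n" for i
    using col_n[of i] that by (simp add: leg_length_eq[OF part] gap_def)
  have bead_nonneg: "0 \<le> bead \<mu> i \<longleftrightarrow> i < n" for i
    using row_n[of i] by (auto simp: bead_def)
  have gap_neg: "gap \<mu> i < 0 \<longleftrightarrow> i < n" for i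
    using col_n[of i] by (auto simp: gap_def)
  have gaps: "x \<notin> beads \<mu> \<longleftrightarrow> x \<in> range (gap \<mu>)" for x
    using beads_compl_eq_gaps[OF part] by blast
  have nonneg_beads: "x \<in> beads \<mu> \<longleftrightarrow> (\<exists>i<n. x = bead \<mu> i)" if "0 \<le> x" for x
    using bead_nonneg that by auto
  have neg_gaps: "x \<notin> beads \<mu> \<longleftrightarrow> (\<exists>i<n. x = gap \<mu> i)" if "x < 0" for x
    unfolding gaps using gap_neg that by auto
  show ?thesis
  proof
    assume "\<exists>\<nu>. is_strict_partition \<nu> \<and> is_doubled_distinct_of \<mu> \<nu>"
    then obtain \<nu> where strict: "is_strict_partition \<nu>"
      and frob: "has_frobenius_symbol \<mu> \<nu> (map (\<lambda>x. x - 1) \<nu>)"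
      by (auto simp: is_doubled_distinct_of_def)
    have len: "length \<nu> = n"
      using frob diag by (auto simp: has_frobenius_symbol_def)
    have pos: "0 < \<nu> ! i" if "i < n" for i
      using strict len that nth_mem by (fastforce simp: is_strict_partition_def intro: gr0I)
    have bead_nu: "bead \<mu> i = int (\<nu> ! i)" and gap_nu: "gap \<mu> i = - int (\<nu> ! i)" if "i < n" for i
      using frob len arm[OF that] leg[OF that] pos[OF that] that
      by (auto simp: has_frobenius_symbol_def of_nat_diff)
    have antisym: "x \<in> beads \<mu> \<longleftrightarrow> - x \<notin> beads \<mu>" if "0 < x" for x
      using nonneg_beads[of x] neg_gaps[of "- x"] that by (auto simp: bead_nu gap_nu)
    have "x \<in> beads \<mu> \<longleftrightarrow> - x \<notin> beads \<mu>" if "x \<noteq> 0" for x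
      using antisym[of x] antisym[of "- x"] that by (cases "0 < x") auto
    moreover have "0 \<notin> beads \<mu>"
      using nonneg_beads[of 0] by (auto simp: bead_nu dest: pos)
    ultimately show "skew (beads \<mu>)" unfolding skew_def by blast
  next
    assume skew: "skew (beads \<mu>)"
    define \<nu> where "\<nu> = map (\<lambda>i. nat (bead \<mu> i)) [0..<n]"
    define \<kappa> where "\<kappa> = map (\<lambda>i. nat (- gap \<mu> i)) [0..<n]"
    have "nat (bead \<mu> j) < nat (bead \<mu> i)" if "i < j" "j < n" for i j
      using bead_strict_antimono[OF part that(1)] bead_nonneg[of j] that(2) by linarith
    then have dec_nu: "sorted_wrt (>) \<nu>"
      by (simp add: \<nu>_def sorted_wrt_iff_nth_less)
    have "nat (- gap \<mu> j) < nat (- gap \<mu> i)" if "i < j" "j < n" for i j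
      using gap_strict_mono[OF part that(1)] gap_neg[of j] that(2) by linarith
    then have dec_kappa: "sorted_wrt (>) \<kappa>"
      by (simp add: \<kappa>_def sorted_wrt_iff_nth_less)
    have set_nu: "x \<in> set \<nu> \<longleftrightarrow> int x \<in> beads \<mu>" for x
    proof -
      have "x = nat (bead \<mu> i) \<longleftrightarrow> int x = bead \<mu> i" if "i < n" for i
        using bead_nonneg[of i] that by auto
      moreover have "x \<in> set \<nu> \<longleftrightarrow> (\<exists>i<n. x = nat (bead \<mu> i))"
        by (auto simp: \<nu>_def)
      ultimately have "x \<in> set \<nu> \<longleftrightarrow> (\<exists>i<n. int x = bead \<mu> i)" by blast
      then show ?thesis using nonneg_beads[of "int x"] by simp
    qed
    have set_kappa: "x \<in> set \<kappa> \<longleftrightarrow> 0 < x \<and> - int x \<notin> beads \<mu>" for x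
    proof -
      have "x = nat (- gap \<mu> i) \<longleftrightarrow> 0 < x \<and> - int x = gap \<mu> i" if "i < n" for i
        using gap_neg[of i] that by auto
      moreover have "x \<in> set \<kappa> \<longleftrightarrow> (\<exists>i<n. x = nat (- gap \<mu> i))"
        by (auto simp: \<kappa>_def)
      ultimately have "x \<in> set \<kappa> \<longleftrightarrow> 0 < x \<and> (\<exists>i<n. - int x = gap \<mu> i)" by blast
      then show ?thesis using neg_gaps[of "- int x"] by auto
    qed
    have "x \<in> set \<nu> \<longleftrightarrow> x \<in> set \<kappa>" for x
      using skew_zero[OF skew] skew_uminus[OF skew, of "int x"]
      by (cases "x = 0") (simp_all add: set_nu set_kappa)
    then have "set \<nu> = set \<kappa>" by blast
    then have "\<nu> = \<kappa>"
      using dec_nu dec_kappa by (intro strictly_decreasing_lists_eqI)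
    then have eq: "bead \<mu> i = - gap \<mu> i" if "i < n" for i
      using that bead_nonneg[of i] gap_neg[of i] by (auto simp: \<nu>_def \<kappa>_def list_eq_iff_nth_eq)
    have "0 \<notin> set \<nu>" using skew_zero[OF skew] set_nu by simp
    then have "is_strict_partition \<nu>"
      using dec_nu by (simp add: is_strict_partition_def)
    moreover have "is_doubled_distinct_of \<mu> \<nu>"
      unfolding is_doubled_distinct_of_def has_frobenius_symbol_def
      using part diag arm leg eq by (force simp: \<nu>_def)
    ultimately show "\<exists>\<nu>. is_strict_partition \<nu> \<and> is_doubled_distinct_of \<mu> \<nu>" by blast
  qed
qed

section \<open>Partitions with a prescribed skew bead set\<close>

lemma partition_eqI:
  assumes "is_partition \<mu>" "is_partition \<mu>'" "row \<mu> = row \<mu>'"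
  shows "\<mu> = \<mu>'"
proof -
  have len: "i < length \<kappa> \<longleftrightarrow> row \<kappa> i \<noteq> 0" if "is_partition \<kappa>" for \<kappa> i
  proof
    assume "i < length \<kappa>"
    then show "row \<kappa> i \<noteq> 0"
      using that nth_mem[of i \<kappa>] by (metis is_partition_def row_def)
  qed (auto simp: row_def split: if_splits)
  have "i < length \<mu> \<longleftrightarrow> i < length \<mu>'" for i
    using len assms by metis
  then have "length \<mu> = length \<mu>'"
    by (metis linorder_neqE_nat less_irrefl)
  with assms(3) show ?thesis
    by (metis nth_equalityI row_def)
qed

text \<open>The beads of a partition form a strictly decreasing sequence, which is determined by its set of
  values.\<close>
lemma inj_on_beads: "inj_on beads {\<mu>. is_partition \<mu>}"
proof (rule inj_onI, simp)
  fix \<mu> \<mu>' assume part: "is_partition \<mu>" "is_partition \<mu>'" and eq: "beads \<mu> = beads \<mu>'"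
  have le: "bead \<kappa>' i \<le> bead \<kappa> i"
    if part: "is_partition \<kappa>" "is_partition \<kappa>'" and eq: "beads \<kappa> = beads \<kappa>'"
      and IH: "\<And>r. r < i \<Longrightarrow> bead \<kappa> r = bead \<kappa>' r" for \<kappa> \<kappa>' i
  proof -
    obtain r where r: "bead \<kappa>' i = bead \<kappa> r" using eq by blast
    have "i \<le> r"
    proof (rule ccontr)
      assume "\<not> i \<le> r"
      then show False
        using IH[of r] r bead_strict_antimono[OF part(2), of r i] by simp
    qed
    then show ?thesis
      using r bead_strict_antimono[OF part(1), of i r] by (cases "i = r") auto
  qed
  have "bead \<mu> i = bead \<mu>' i" for i
  proof (induction i rule: less_induct)
    case (less i)
    then show ?case
      using le[of \<mu> \<mu>' i] le[of \<mu>' \<mu> i] part eq by (simp add: order_antisym)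
  qed
  then have "row \<mu> = row \<mu>'"
    by (intro ext) (simp add: bead_def)
  with part show "\<mu> = \<mu>'" by (rule partition_eqI)
qed

lemma partition_with_rows:
  assumes anti: "\<And>i j. i \<le> j \<Longrightarrow> r j \<le> r i" and zero: "r N = (0::nat)"
  obtains \<mu> where "is_partition \<mu>" "row \<mu> = r"
proof -
  define k where "k = (LEAST i. r i = 0)"
  have k: "r k = 0" unfolding k_def using zero by (rule LeastI)
  have nz: "r i \<noteq> 0" if "i < k" for i
    using that not_less_Least unfolding k_def by blast
  have "is_partition (map r [0..<k])"
    using nz by (fastforce simp: is_partition_def sorted_wrt_iff_nth_less anti)
  moreover have "row (map r [0..<k]) = r"
    using anti[of k] k by (fastforce simp: row_def)
  ultimately show ?thesis by (rule that)
qed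

lemma strictly_increasing_nth_diff:
  fixes ys :: "int list"
  assumes "sorted_wrt (<) ys" "a \<le> b" "b < length ys"
  shows "int b - int a \<le> ys ! b - ys ! a"
  using assms(2,3)
proof (induction b rule: dec_induct)
  case (step b)
  then have "ys ! b < ys ! Suc b"
    using assms(1) by (simp add: sorted_wrt_iff_nth_less)
  with step show ?case by simp
qed simp

text \<open>Exactly one of \<open>x\<close> and \<open>- x\<close> is in the set for each \<open>x = 1, \<dots>, N\<close>. This count provides the
  balance between non-negative beads and negative gaps that distinguishes bead sets of partitions from
  their translates.\<close>
lemma skew_balanced:
  assumes skew: "skew X" and bound: "\<And>x. x \<in> X \<Longrightarrow> x \<le> int N"
  shows "card (X \<inter> {- int N..int N}) = N"
proof -
  define P where "P = X \<inter> {1..int N}"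
  have P: "finite P" "P \<subseteq> {1..int N}" by (auto simp: P_def)
  have "X \<inter> {- int N..int N} = P \<union> uminus ` ({1..int N} - P)"
  proof (intro equalityI subsetI)
    fix x assume x: "x \<in> X \<inter> {- int N..int N}"
    then have "x \<noteq> 0" using skew_zero[OF skew] by auto
    show "x \<in> P \<union> uminus ` ({1..int N} - P)"
    proof (cases "0 < x")
      case True
      with x show ?thesis by (auto simp: P_def)
    next
      case False
      with x \<open>x \<noteq> 0\<close> have "- x \<in> {1..int N} - P"
        using skew_uminus[OF skew, of x] by (auto simp: P_def)
      then show ?thesis by (auto intro: image_eqI[where x = "- x"])
    qed
  next
    fix x assume "x \<in> P \<union> uminus ` ({1..int N} - P)"
    then show "x \<in> X \<inter> {- int N..int N}"
      using skew_uminus[OF skew] by (auto simp: P_def)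
  qed
  moreover have "P \<inter> uminus ` ({1..int N} - P) = {}"
    by (auto simp: P_def)
  ultimately have "card (X \<inter> {- int N..int N}) = card P + card (uminus ` ({1..int N} - P))"
    using P by (simp add: card_Un_disjoint)
  also have "card (uminus ` ({1..int N} - P)) = card ({1..int N} - P)"
    by (intro card_image inj_onI) simp
  also have "\<dots> = N - card P"
    using P by (simp add: card_Diff_subset)
  also have "card P + (N - card P) = N"
    using card_mono[OF _ P(2)] by simp
  finally show ?thesis .
qed

text \<open>The elements of \<open>X\<close> in \<open>{- N..N}\<close>, listed in decreasing order, are the beads of the first \<open>N\<close>
  rows. All integers below \<open>- N\<close> belong to \<open>X\<close>; they are the beads of the empty rows, since there are
  exactly \<open>N\<close> elements above them.\<close>
lemma skew_set_is_beads:
  assumes skew: "skew X" and bound: "\<And>x. x \<in> X \<Longrightarrow> x \<le> int N"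
  obtains \<mu> where "is_partition \<mu>" "beads \<mu> = X"
proof -
  define A where "A = X \<inter> {- int N..int N}"
  define ys where "ys = sorted_list_of_set A"
  have set_ys: "set ys = A" by (simp add: ys_def A_def)
  have inc: "sorted_wrt (<) ys" by (simp add: ys_def)
  have len: "length ys = N"
    using skew_balanced[OF assms] by (simp add: ys_def A_def)
  define x where "x i = ys ! (N - 1 - i)" for i
  have x_ge: "- int i - 1 \<le> x i" if "i < N" for i
  proof -
    have "- int N \<le> ys ! 0"
      using nth_mem[of 0 ys] that len set_ys by (auto simp: A_def)
    with strictly_increasing_nth_diff[OF inc, of 0 "N - 1 - i"] that len show ?thesis
      by (simp add: x_def)
  qed
  have x_diff: "int j - int i \<le> x i - x j" if "i \<le> j" "j < N" for i j
    using strictly_increasing_nth_diff[OF inc, of "N - 1 - j" "N - 1 - i"] that len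
    by (simp add: x_def)
  define r where "r i = (if i < N then nat (x i + int i + 1) else 0)" for i
  have "r j \<le> r i" if "i \<le> j" for i j
    using x_diff[of i j] that by (auto simp: r_def)
  then obtain \<mu> where part: "is_partition \<mu>" and row: "row \<mu> = r"
    by (rule partition_with_rows[where r = r and N = N]) (auto simp: r_def)
  have bead: "bead \<mu> i = (if i < N then x i else - int i - 1)" for i
    using x_ge[of i] by (cases "i < N") (simp_all add: bead_def row r_def)
  have "beads \<mu> = X"
  proof (intro equalityI subsetI)
    fix y assume "y \<in> beads \<mu>"
    then obtain i where y: "y = bead \<mu> i" by blast
    show "y \<in> X"
    proof (cases "i < N")
      case True
      then have "x i \<in> set ys" unfolding x_def using len by (intro nth_mem) simp
      with True y bead set_ys show ?thesis by (simp add: A_def)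
    next
      case False
      then have "int i + 1 \<notin> X" using bound[of "int i + 1"] by auto
      then have "- (int i + 1) \<in> X"
        using skew_uminus[OF skew, of "int i + 1"] by simp
      with False y bead show ?thesis by simp
    qed
  next
    fix y assume y: "y \<in> X"
    show "y \<in> beads \<mu>"
    proof (cases "- int N \<le> y")
      case True
      then have "y \<in> set ys" using y bound set_ys by (auto simp: A_def)
      then obtain a where "a < N" "y = ys ! a" using len by (auto simp: in_set_conv_nth)
      then have "y = bead \<mu> (N - 1 - a)" by (simp add: bead x_def)
      then show ?thesis by blast
    next
      case False
      then have "y = bead \<mu> (nat (- y - 1))" by (auto simp: bead)
      then show ?thesis by blast
    qed
  qed
  with part that show ?thesis by blast
qed

definition core_sets :: "nat \<Rightarrow> nat \<Rightarrow> int set set" where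
  "core_sets s d = {X. skew X \<and> (\<forall>u \<in> {s, s + d, s + 2 * d}. down_closed u X)}"

text \<open>Every integer \<open>x \<ge> s t\<close> is a combination \<open>a s + b t\<close> with \<open>a, b \<ge> 0\<close>, so such an element could
  be taken down to \<open>0\<close>.\<close>
lemma down_closed_bounded:
  assumes coprime: "coprime s t" and "s > 0"
    and "0 \<notin> X" "down_closed s X" "down_closed t X" "x \<in> X"
  shows "x < int s * int t"
proof (rule ccontr)
  assume "\<not> x < int s * int t"
  then have large: "int s * int t \<le> x" by simp
  obtain u v where uv: "u * int s + v * int t = 1"
    using bezout_int[of "int s" "int t"] coprime by auto
  \<comment> \<open>Reducing the coefficient of \<open>t\<close> modulo \<open>s\<close> keeps it so small that the other one is non-negative.\<close>
  define b where "b = (x * v) mod int s"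
  define q where "q = (x * v) div int s"
  have xv: "x * v = b + q * int s" by (simp add: b_def q_def)
  have b: "0 \<le> b" "b \<le> int s - 1"
    using \<open>s > 0\<close> by (auto simp: b_def zle_diff1_eq)
  define a where "a = x * u + q * int t"
  have "x = x * (u * int s + v * int t)" by (simp add: uv)
  also have "\<dots> = x * u * int s + (x * v) * int t" by (simp add: algebra_simps)
  also have "\<dots> = a * int s + b * int t" unfolding xv by (simp add: a_def algebra_simps)
  finally have x: "x = a * int s + b * int t" .
  have "b * int t \<le> (int s - 1) * int t"
    using b by (intro mult_right_mono) auto
  then have "0 \<le> a * int s"
    using large x by (simp add: algebra_simps)
  then have "0 \<le> a" using \<open>s > 0\<close> by (simp add: zero_le_mult_iff)
  have "x - int (nat b) * int t \<in> X"
    using assms by (intro down_closed_multiple)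
  then have "x - int (nat b) * int t - int (nat a) * int s \<in> X"
    using assms by (intro down_closed_multiple)
  then show False using b \<open>0 \<le> a\<close> x \<open>0 \<notin> X\<close> by simp
qed

lemma bij_betw_beads:
  assumes "s > 0" "coprime s d"
  shows "bij_betw beads (DD_cores s (s + d) (s + 2 * d)) (core_sets s d)"
proof -
  have mem: "\<mu> \<in> DD_cores s (s + d) (s + 2 * d) \<longleftrightarrow> is_partition \<mu> \<and> beads \<mu> \<in> core_sets s d" for \<mu>
  proof (cases "is_partition \<mu>")
    case True
    then show ?thesis
      using assms(1) doubled_distinct_iff_skew[OF True]
      by (simp add: DD_cores_def core_sets_def is_core_iff_down_closed)
  qed (auto simp: DD_cores_def is_doubled_distinct_of_def)
  have "X \<in> beads ` DD_cores s (s + d) (s + 2 * d)" if X: "X \<in> core_sets s d" for X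
  proof -
    have skew: "skew X" using X by (simp add: core_sets_def)
    have "coprime s (s + d)" using assms(2) unfolding coprime_iff_gcd_eq_1 by simp
    then have "x \<le> int (s * (s + d))" if "x \<in> X" for x
      using down_closed_bounded[of s "s + d" X x] assms(1) X that skew_zero[OF skew]
      by (simp add: core_sets_def)
    then obtain \<mu> where "is_partition \<mu>" "beads \<mu> = X"
      using skew_set_is_beads[OF skew] by blast
    then show ?thesis using X mem by blast
  qed
  moreover have "inj_on beads (DD_cores s (s + d) (s + 2 * d))"
    by (rule inj_on_subset[OF inj_on_beads]) (auto simp: mem)
  ultimately show ?thesis
    unfolding bij_betw_def using mem by blast
qed

section \<open>Core sets as regions below quasi-periodic Motzkin paths\<close>

definition height_functions :: "nat \<Rightarrow> nat \<Rightarrow> (int \<Rightarrow> int) set" where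
  "height_functions t d = {h. h 0 = 0 \<and> (\<forall>i. h (i + int t) = h i - int d) \<and>
     (\<forall>i. \<bar>h (i + 1) - h i\<bar> \<le> 1) \<and> (\<forall>i. \<not> int t dvd i \<longrightarrow> h (- i) = 1 - h i)}"

definition region :: "nat \<Rightarrow> nat \<Rightarrow> (int \<Rightarrow> int) \<Rightarrow> int set" where
  "region t d h = {i * int d + j * int t | i j. j < h i}"

lemma quasiperiodic_shift:
  fixes h :: "int \<Rightarrow> int"
  assumes per: "\<And>i. h (i + t) = h i - d"
  shows "h (i + q * t) = h i - q * d"
proof (induction q rule: int_induct[where k = 0])
  case (step1 q)
  then show ?case using per[of "i + q * t"] by (simp add: algebra_simps)
next
  case (step2 q)
  then show ?case using per[of "i + (q - 1) * t"] by (simp add: algebra_simps)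
qed simp

lemma lattice_representation:
  assumes "coprime t d"
  obtains i j where "x = i * int d + j * int t"
proof -
  obtain u v where "u * int d + v * int t = 1"
    using bezout_int[of "int d" "int t"] assms by (auto simp: coprime_commute)
  then have "x = x * (u * int d + v * int t)" by simp
  then have "x = (x * u) * int d + (x * v) * int t" by (simp add: algebra_simps)
  then show ?thesis by (rule that)
qed

text \<open>An integer has many representations \<open>i d + j t\<close>; the rule \<open>h (i + t) = h i - d\<close> makes
  the position relative to the graph of \<open>h\<close> the same for all of them.\<close>
lemma region_iff:
  assumes "coprime t d" "t > 0" and h: "h \<in> height_functions t d"
  shows "i * int d + j * int t \<in> region t d h \<longleftrightarrow> j < h i"
proof
  assume "i * int d + j * int t \<in> region t d h"
  then obtain i' j' where eq: "i * int d + j * int t = i' * int d + j' * int t" and less: "j' < h i'"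
    by (auto simp: region_def)
  then have eq': "(i - i') * int d = (j' - j) * int t" by (simp add: algebra_simps)
  then have "int t dvd (i - i') * int d" by simp
  then have "int t dvd i - i'"
    using assms(1) by (simp add: coprime_dvd_mult_left_iff)
  then obtain q where "i - i' = int t * q" by (elim dvdE)
  then have q: "i = i' + q * int t" by (simp add: algebra_simps)
  then have "q * int d * int t = (j' - j) * int t" using eq' by (simp add: algebra_simps)
  then have "q * int d = j' - j" using assms(2) by simp
  moreover have "h i = h i' - q * int d"
    unfolding q using h by (intro quasiperiodic_shift) (simp add: height_functions_def)
  ultimately show "j < h i" using less by simp
qed (auto simp: region_def)

lemma region_mem_core_sets:
  assumes "coprime t d" "t > 0" "t = s + d" and h: "h \<in> height_functions t d"
  shows "region t d h \<in> core_sets s d"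
proof -
  note iff = region_iff[OF assms(1,2) h]
  have zero: "h 0 = 0" and anti: "\<And>i. \<not> int t dvd i \<Longrightarrow> h (- i) = 1 - h i"
    and per: "\<And>i. h (i + int t) = h i - int d" and step: "\<And>i. \<bar>h (i + 1) - h i\<bar> \<le> 1"
    using h by (auto simp: height_functions_def)
  have "x \<in> region t d h \<longleftrightarrow> - x \<notin> region t d h" if "x \<noteq> 0" for x
  proof -
    obtain i j where x: "x = i * int d + j * int t" using lattice_representation[OF assms(1)] .
    then have "- x = (- i) * int d + (- j) * int t" by simp
    then have minus: "- x \<in> region t d h \<longleftrightarrow> - j < h (- i)" using iff by metis
    have "j < h i \<longleftrightarrow> \<not> - j < h (- i)"
    proof (cases "int t dvd i")
      case False
      then show ?thesis using anti[of i] by auto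
    next
      case True
      then obtain q where q: "i = q * int t" by (metis dvdE mult.commute)
      have "h i = - q * int d" "h (- i) = q * int d"
        using quasiperiodic_shift[of h, OF per, of 0 q] quasiperiodic_shift[of h, OF per, of 0 "- q"]
        by (simp_all add: q zero)
      moreover have "j \<noteq> - q * int d"
        using that by (auto simp: x q)
      ultimately show ?thesis by auto
    qed
    then show ?thesis using minus iff x by metis
  qed
  moreover have "0 \<notin> region t d h" using iff[of 0 0] zero by simp
  ultimately have "skew (region t d h)" unfolding skew_def by blast
  moreover have "x - int u \<in> region t d h" if x_mem: "x \<in> region t d h" and u: "u \<in> {s, s + d, s + 2 * d}" for x u
  proof -
    obtain i j where x: "x = i * int d + j * int t" and less: "j < h i"
      using x_mem by (auto simp: region_def)
    have "x - int s = (i + 1) * int d + (j - 1) * int t"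
      "x - int (s + d) = i * int d + (j - 1) * int t"
      "x - int (s + 2 * d) = (i - 1) * int d + (j - 1) * int t"
      by (simp_all add: x assms(3) algebra_simps)
    moreover have "j - 1 < h (i + 1)" "j - 1 < h i" "j - 1 < h (i - 1)"
      using less step[of i] step[of "i - 1"] by auto
    ultimately show ?thesis using u iff by auto
  qed
  ultimately show ?thesis
    unfolding core_sets_def down_closed_def by blast
qed

lemma down_closed_int_threshold:
  fixes S :: "int set"
  assumes down: "\<And>j. j \<in> S \<Longrightarrow> j - 1 \<in> S" and "a \<in> S" "b \<notin> S"
  obtains m where "\<And>j. j \<in> S \<longleftrightarrow> j < m"
proof -
  have below: "i \<in> S" if "j \<in> S" "i \<le> j" for i j
    using that(2) by (induction i rule: int_le_induct) (auto intro: that(1) down)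
  have "a < b" using below[of a b] assms(2,3) by force
  then have "a + int (nat (b - a)) \<notin> S" using assms(3) by simp
  define n where "n = (LEAST n. a + int n \<notin> S)"
  have n: "a + int n \<notin> S"
    unfolding n_def using \<open>a + int (nat (b - a)) \<notin> S\<close> by (rule LeastI)
  have "j \<in> S \<longleftrightarrow> j < a + int n" for j
  proof
    assume "j \<in> S"
    then show "j < a + int n" using below[of j "a + int n"] n by linarith
  next
    assume less: "j < a + int n"
    show "j \<in> S"
    proof (cases "j \<le> a")
      case False
      then have "nat (j - a) < n" using less by simp
      then have "a + int (nat (j - a)) \<in> S" using not_less_Least unfolding n_def by blast
      with False show ?thesis by simp
    qed (use below assms(2) in blast)
  qed
  then show ?thesis by (rule that)
qed

text \<open>Closure under subtraction of \<open>t\<close> makes each column \<open>{j. i d + j t \<in> X}\<close> a down-set; it is neither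
  empty nor everything because \<open>X\<close> is bounded above and skew, so \<open>h i\<close> can be
  taken as its threshold. The four conditions on \<open>h\<close> then read off those on \<open>X\<close>.\<close>
lemma core_set_is_region:
  assumes cop: "coprime t d" and "t = s + d" "s > 0" and X: "X \<in> core_sets s d"
  obtains h where "h \<in> height_functions t d" "region t d h = X"
proof -
  have skew: "skew X" and
    closed: "down_closed s X" "down_closed t X" "down_closed (s + 2 * d) X"
    using X assms(2) by (auto simp: core_sets_def)
  have t: "t > 0" using assms by simp
  have "coprime s t"
    using cop unfolding assms(2) by (metis add.commute coprime_commute coprime_iff_gcd_eq_1 gcd_add2)
  then have bounded: "x < int s * int t" if "x \<in> X" for x
    using that closed assms(3) skew_zero[OF skew] by (intro down_closed_bounded)
  have "\<exists>m. \<forall>j. i * int d + j * int t \<in> X \<longleftrightarrow> j < m" for i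
  proof -
    let ?S = "{j. i * int d + j * int t \<in> X}"
    \<comment> \<open>Chosen such that row \<open>c\<close> of this column lies above the bound \<open>s t\<close> for \<open>X\<close>, and row \<open>- c\<close>
      below its negative.\<close>
    define c where "c = int s + \<bar>i\<bar> * int d"
    have "1 \<le> int t" using t by simp
    have "\<bar>i\<bar> * int d * 1 \<le> \<bar>i\<bar> * int d * int t"
      using \<open>1 \<le> int t\<close> by (intro mult_left_mono) auto
    then have "int s * int t + \<bar>i\<bar> * int d \<le> c * int t"
      by (simp add: c_def algebra_simps)
    moreover have "\<bar>i * int d\<bar> = \<bar>i\<bar> * int d" by (simp add: abs_mult)
    ultimately have c: "int s * int t \<le> i * int d + c * int t" "int s * int t \<le> - (i * int d + (- c) * int t)"
      by (simp_all add: abs_if split: if_splits)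
    have "c \<notin> ?S" using bounded c(1) by force
    have "0 < int s * int t" using t assms(3) by simp
    then have "i * int d + (- c) * int t \<in> X"
      using bounded c(2) skew_uminus[OF skew, of "i * int d + (- c) * int t"] by force
    then have "- c \<in> ?S" by simp
    have "j - 1 \<in> ?S" if "j \<in> ?S" for j
    proof -
      have "i * int d + j * int t - int t \<in> X" using that closed(2) by (simp add: down_closed_def)
      then show ?thesis by (simp add: algebra_simps)
    qed
    then obtain m where "\<And>j. j \<in> ?S \<longleftrightarrow> j < m"
      using down_closed_int_threshold[of ?S "- c" c] \<open>- c \<in> ?S\<close> \<open>c \<notin> ?S\<close> by blast
    then show ?thesis by auto
  qed
  then obtain h where iff: "\<And>i j. i * int d + j * int t \<in> X \<longleftrightarrow> j < h i" by metis
  have "h 0 = 0"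
  proof -
    have "int t \<notin> X" using closed(2) skew_zero[OF skew] by (force simp: down_closed_def)
    then have "- int t \<in> X" using skew_uminus[OF skew, of "int t"] t by simp
    then show ?thesis using iff[of 0 0] iff[of 0 "- 1"] skew_zero[OF skew] by simp
  qed
  moreover have "h (i + int t) = h i - int d" for i
  proof -
    have "j < h (i + int t) \<longleftrightarrow> j < h i - int d" for j
      using iff[of "i + int t" j] iff[of i "j + int d"] by (auto simp: algebra_simps)
    then show ?thesis by (meson not_less_iff_gr_or_eq)
  qed
  moreover have "\<bar>h (i + 1) - h i\<bar> \<le> 1" for i
  proof -
    have "i * int d + (h i - 1) * int t - int s \<in> X"
      using iff[of i "h i - 1"] closed(1) by (simp add: down_closed_def)
    moreover have "i * int d + (h i - 1) * int t - int s = (i + 1) * int d + (h i - 2) * int t"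
      by (simp add: assms(2) algebra_simps)
    ultimately have "h i - 2 < h (i + 1)" using iff by metis
    have "(i + 1) * int d + (h (i + 1) - 1) * int t - int (s + 2 * d) \<in> X"
      using iff[of "i + 1" "h (i + 1) - 1"] closed(3) unfolding down_closed_def by auto
    moreover have "(i + 1) * int d + (h (i + 1) - 1) * int t - int (s + 2 * d)
        = i * int d + (h (i + 1) - 2) * int t"
      by (simp add: assms(2) algebra_simps)
    ultimately have "h (i + 1) - 2 < h i" using iff by metis
    with \<open>h i - 2 < h (i + 1)\<close> show ?thesis by simp
  qed
  moreover have "h (- i) = 1 - h i" if "\<not> int t dvd i" for i
  proof -
    have flip: "- j < h (- i) \<longleftrightarrow> \<not> j < h i" for j
    proof -
      have "i * int d + j * int t \<noteq> 0"
      proof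
        assume "i * int d + j * int t = 0"
        then have "i * int d = int t * (- j)" by (simp add: algebra_simps)
        then have "int t dvd i * int d" by simp
        with that cop show False by (simp add: coprime_dvd_mult_left_iff)
      qed
      then have "- (i * int d + j * int t) \<in> X \<longleftrightarrow> i * int d + j * int t \<notin> X"
        by (rule skew_uminus[OF skew])
      moreover have "- (i * int d + j * int t) = (- i) * int d + (- j) * int t" by simp
      ultimately show ?thesis using iff by metis
    qed
    show ?thesis using flip[of "h i"] flip[of "h i - 1"] by simp
  qed
  ultimately have h: "h \<in> height_functions t d" by (simp add: height_functions_def)
  have "x \<in> region t d h \<longleftrightarrow> x \<in> X" for x
    using lattice_representation[OF cop, of x] iff region_iff[OF cop t h] by metis
  then have "region t d h = X" by blast
  with h show ?thesis by (rule that)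
qed

lemma bij_betw_region:
  assumes "coprime t d" "t = s + d" "s > 0"
  shows "bij_betw (region t d) (height_functions t d) (core_sets s d)"
proof -
  have t: "t > 0" using assms by simp
  have "h = h'" if "h \<in> height_functions t d" "h' \<in> height_functions t d" "region t d h = region t d h'"
    for h h'
  proof
    fix i
    have "j < h i \<longleftrightarrow> j < h' i" for j
      using that region_iff[OF assms(1) t] by metis
    then show "h i = h' i" by (meson not_less_iff_gr_or_eq)
  qed
  then have "inj_on (region t d) (height_functions t d)" by (auto intro: inj_onI)
  then show ?thesis
    unfolding bij_betw_def using region_mem_core_sets[OF assms(1) t assms(2)] core_set_is_region[OF assms]
    by (metis subset_antisym image_subsetI subsetI image_eqI)
qed

section \<open>Heights along a path\<close>

definition path_height :: "step list \<Rightarrow> nat \<Rightarrow> int" where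
  "path_height p i = (\<Sum>x\<leftarrow>take i p. rise x)"

lemma path_height_0 [simp]: "path_height p 0 = 0"
  by (simp add: path_height_def)

lemma path_height_length: "path_height p (length p) = (\<Sum>x\<leftarrow>p. rise x)"
  by (simp add: path_height_def)

lemma path_height_Suc: "i < length p \<Longrightarrow> path_height p (Suc i) = path_height p i + rise (p ! i)"
  by (simp add: path_height_def take_Suc_conv_app_nth)

lemma abs_rise_le: "\<bar>rise x\<bar> \<le> 1"
  by (cases x) auto

lemma rise_inject: "rise x = rise y \<longleftrightarrow> x = y"
  by (cases x; cases y) auto

lemma prefix_Up_iff: "prefix [Up] p \<longleftrightarrow> p \<noteq> [] \<and> p ! 0 = Up"
  by (cases p) auto

lemma path_with_heights:
  assumes "g 0 = (0::int)" "\<And>i. i < k \<Longrightarrow> \<bar>g (Suc i) - g i\<bar> \<le> 1"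
  obtains p where "length p = k" "\<And>i. i \<le> k \<Longrightarrow> path_height p i = g i"
proof -
  have "\<exists>p. length p = k \<and> (\<forall>i\<le>k. path_height p i = g i)"
    using assms(2)
  proof (induction k)
    case 0
    then show ?case using assms(1) by simp
  next
    case (Suc k)
    then obtain p where p: "length p = k" "\<forall>i\<le>k. path_height p i = g i" by auto
    have "g (Suc k) - g k \<in> {-1, 0, 1}" using Suc.prems[of k] by auto
    then obtain x where x: "rise x = g (Suc k) - g k" by (metis insertE empty_iff rise.simps)
    have "path_height (p @ [x]) i = g i" if "i \<le> Suc k" for i
    proof (cases "i = Suc k")
      case True
      then show ?thesis using p(1) spec[OF p(2), of k] x by (simp add: path_height_def)
    next
      case False
      then have "i \<le> k" using that by simp
      then show ?thesis using p by (simp add: path_height_def)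
    qed
    then show ?case using p(1) by (intro exI[of _ "p @ [x]"]) simp
  qed
  then show ?thesis using that by blast
qed

lemma path_eqI:
  assumes "length p = length q" "\<And>i. i \<le> length p \<Longrightarrow> path_height p i = path_height q i"
  shows "p = q"
proof (rule nth_equalityI[OF assms(1)])
  fix i assume "i < length p"
  then have "rise (p ! i) = rise (q ! i)"
    using assms(2)[of i] assms(2)[of "Suc i"] assms(1) by (simp add: path_height_Suc)
  then show "p ! i = q ! i" by (simp add: rise_inject)
qed

section \<open>Quasi-periodic Motzkin paths as unfolded half paths\<close>

text \<open>The common form of the paths in all three parities. The condition on the total rise is the
  compatibility with the reflection at the middle of a period.\<close>
definition half_paths :: "nat \<Rightarrow> nat \<Rightarrow> step list set" where
  "half_paths t d = {p. length p = t div 2 \<and> \<not> prefix [Up] p \<and>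
     \<bar>2 * (\<Sum>x\<leftarrow>p. rise x) + int d + 1\<bar> \<le> 1}"

text \<open>The bi-infinite path generated by a half path: raised by \<open>1\<close> except at \<open>0\<close>, reflected by
  \<open>h (t - r) = 1 - d - h r\<close> on the second half of the period, and continued by \<open>h (i + t) = h i - d\<close>.\<close>
definition unfold_path :: "nat \<Rightarrow> nat \<Rightarrow> step list \<Rightarrow> int \<Rightarrow> int" where
  "unfold_path t d p i =
     (let r = nat (i mod int t)
      in (if r = 0 then 0 else if r \<le> t div 2 then 1 + path_height p r
          else - int d - path_height p (t - r)) - (i div int t) * int d)"

lemma unfold_path_shift:
  assumes "t > 0"
  shows "unfold_path t d p (i + q * int t) = unfold_path t d p i - q * int d"
  using assms by (simp add: unfold_path_def Let_def algebra_simps)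

lemma unfold_path_zero [simp]: "unfold_path t d p 0 = 0"
  by (simp add: unfold_path_def)

lemma unfold_path_lower:
  assumes "0 < r" "r \<le> t div 2"
  shows "unfold_path t d p (int r) = 1 + path_height p r"
proof -
  have "r < t" using assms by simp
  then show ?thesis using assms by (simp add: unfold_path_def)
qed

text \<open>For even \<open>t\<close> the middle of the period is its own reflection. The number \<open>2 n + d + 1\<close>
  is then even, so the bound \<open>1\<close> on its absolute value forces it to vanish.\<close>
lemma half_path_midpoint:
  assumes "p \<in> half_paths t d" "even t" "odd d"
  shows "2 * path_height p (t div 2) = - int d - 1"
proof -
  have "length p = t div 2" and *: "\<bar>2 * (\<Sum>x\<leftarrow>p. rise x) + int d + 1\<bar> \<le> 1"
    using assms(1) by (simp_all add: half_paths_def)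
  moreover obtain c where "d = 2 * c + 1" using assms(3) by (elim oddE)
  ultimately show ?thesis using path_height_length[of p] by simp presburger
qed

text \<open>The reflected formula also holds at the two boundary points of the second half: at \<open>r = t\<close>, and,
  for even \<open>t\<close>, at the middle, where it meets the formula of the first half. With this overlap each
  step of the unfolded path lies in one of the two halves or, for odd \<open>t\<close>, crosses the middle.\<close>
lemma unfold_path_upper:
  assumes p: "p \<in> half_paths t d" and "coprime t d" "t > 0" and r: "t - t div 2 \<le> r" "r \<le> t"
  shows "unfold_path t d p (int r) = - int d - path_height p (t - r)"
proof -
  consider "r = t" | "r < t" "r \<le> t div 2" | "r < t" "t div 2 < r" using r by linarith
  then show ?thesis
  proof cases
    case 1
    then show ?thesis using unfold_path_shift[OF assms(3), of d p 0 1] by simp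
  next
    case 2
    then have r_eq: "r = t div 2" "t - r = t div 2" and "t = 2 * (t div 2)"
      using r by linarith+
    then have even: "even t" by (metis dvd_triv_left)
    then have "odd d" using assms(2) by auto
    then show ?thesis
      using half_path_midpoint[OF p even] unfold_path_lower[of r t d p] r_eq \<open>t > 0\<close> \<open>t = _\<close> by simp
  next
    case 3
    then show ?thesis by (simp add: unfold_path_def)
  qed
qed

lemma int_div_mod_nat:
  assumes "t > 0"
  obtains r q where "i = int r + q * int t" "r < t"
proof
  show "i = int (nat (i mod int t)) + (i div int t) * int t" using assms by simp
  show "nat (i mod int t) < t" using assms by (simp add: nat_less_iff)
qed

lemma unfold_path_mem:
  assumes p: "p \<in> half_paths t d" and cop: "coprime t d" and t: "t \<ge> 2"
  shows "unfold_path t d p \<in> height_functions t d"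
proof -
  have t0: "t > 0" using t by simp
  let ?h = "unfold_path t d p" and ?k = "t div 2"
  note shift = unfold_path_shift[OF t0, of d p]
  note lower = unfold_path_lower[where t = t and d = d and p = p]
  note upper = unfold_path_upper[OF p cop t0]
  have len: "length p = ?k" and not_Up: "\<not> prefix [Up] p"
    and mid: "\<bar>2 * path_height p ?k + int d + 1\<bar> \<le> 1"
    using p by (auto simp: half_paths_def path_height_length[symmetric])
  have path_step: "\<bar>path_height p (Suc r) - path_height p r\<bar> \<le> 1" if "r < ?k" for r
    using path_height_Suc[of r p] abs_rise_le[of "p ! r"] that len by simp
  have first: "path_height p (Suc 0) \<in> {-1, 0}"
  proof -
    have "p \<noteq> []" using len t by auto
    then have "p ! 0 \<noteq> Up" using not_Up by (simp add: prefix_Up_iff)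
    then show ?thesis
      using path_height_Suc[of 0 p] \<open>p \<noteq> []\<close> by (cases "p ! 0") auto
  qed
  have step_r: "\<bar>?h (int (Suc r)) - ?h (int r)\<bar> \<le> 1" if "r < t" for r
  proof -
    consider "r = 0" | "0 < r" "r < ?k" | "t - ?k \<le> r" | "0 < r" "r = ?k" "Suc r = t - ?k"
      using that by linarith
    then show ?thesis
    proof cases
      case 1
      have "?h (int (Suc 0)) = 1 + path_height p (Suc 0)" using t by (intro lower) auto
      then show ?thesis using 1 first by auto
    next
      case 2
      then show ?thesis using lower[of r] lower[of "Suc r"] path_step[of r] by simp
    next
      case 3
      have "t - r = Suc (t - Suc r)" using that by simp
      then show ?thesis
        using 3 that upper[of r] upper[of "Suc r"] path_step[of "t - Suc r"] by simp
    next
      case 4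
      then have "t - Suc r = ?k" by linarith
      then have "?h (int (Suc r)) = - int d - path_height p ?k"
        using upper[of "Suc r"] 4 that by (metis Suc_leI order_refl)
      moreover have "?h (int r) = 1 + path_height p ?k" using lower[of r] 4 by simp
      ultimately show ?thesis using mid by linarith
    qed
  qed
  have step: "\<bar>?h (i + 1) - ?h i\<bar> \<le> 1" for i
  proof -
    obtain r q where i: "i = int r + q * int t" and r: "r < t" using int_div_mod_nat[OF t0] .
    have "i + 1 = int (Suc r) + q * int t" by (simp add: i)
    then have "?h (i + 1) = ?h (int (Suc r)) - q * int d" by (simp only: shift)
    moreover have "?h i = ?h (int r) - q * int d" by (simp only: i shift)
    ultimately show ?thesis using step_r[OF r] by simp
  qed
  have anti: "?h (- i) = 1 - ?h i" if "\<not> int t dvd i" for i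
  proof -
    obtain r q where i: "i = int r + q * int t" and r: "r < t" using int_div_mod_nat[OF t0] .
    have "r \<noteq> 0" using that i by (cases "r = 0") auto
    have "- i = int (t - r) + (- q - 1) * int t"
      using r by (simp add: i of_nat_diff algebra_simps)
    then have "?h (- i) = ?h (int (t - r)) + (q + 1) * int d"
      using shift[of "int (t - r)" "- q - 1"] by (simp add: algebra_simps)
    moreover have "?h i = ?h (int r) - q * int d" using shift i by simp
    moreover have "?h (int (t - r)) + ?h (int r) = 1 - int d"
    proof (cases "r \<le> ?k")
      case True
      then show ?thesis using lower[of r] upper[of "t - r"] r \<open>r \<noteq> 0\<close> by simp
    next
      case False
      then have "t - r \<le> ?k" "t - ?k \<le> r" by linarith+
      then show ?thesis using lower[of "t - r"] upper[of r] r by simp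
    qed
    ultimately show ?thesis by (simp add: algebra_simps)
  qed
  show ?thesis
    using step anti shift[of _ 1] by (auto simp: height_functions_def)
qed

text \<open>Both \<open>h\<close> and the unfolded path are determined by their values on the first half of the period,
  so the half path is read off there. The reflections \<open>h (- 1) = 1 - h 1\<close> and
  \<open>h (t - k) = 1 - d - h k\<close> with \<open>k = t div 2\<close>, whose arguments \<open>t - k\<close> and \<open>k\<close> differ by at
  most \<open>1\<close>, give the conditions on the first step and on the total rise.\<close>
lemma height_function_unfolds:
  assumes h: "h \<in> height_functions t d" and cop: "coprime t d" and t: "t \<ge> 2"
  obtains p where "p \<in> half_paths t d" "unfold_path t d p = h"
proof -
  have t0: "t > 0" using t by simp
  let ?k = "t div 2"
  have zero: "h 0 = 0" and anti: "\<And>i. \<not> int t dvd i \<Longrightarrow> h (- i) = 1 - h i"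
    and per: "\<And>i. h (i + int t) = h i - int d" and step: "\<And>i. \<bar>h (i + 1) - h i\<bar> \<le> 1"
    using h by (auto simp: height_functions_def)
  have "\<not> int t dvd 1" using t by (auto dest: zdvd_imp_le)
  then have first: "h 1 \<in> {0, 1}"
    using anti[of 1] step[of 0] step[of "- 1"] zero by auto
  have reflect: "h (int (t - r)) = 1 - int d - h (int r)" if "0 < r" "r < t" for r
  proof -
    have "\<not> int t dvd int r" using that by (auto dest: dvd_imp_le)
    then show ?thesis
      using anti[of "int r"] per[of "- int r"] that by (simp add: of_nat_diff)
  qed
  define g where "g i = (if i = 0 then 0 else h (int i) - 1)" for i :: nat
  have "\<bar>g (Suc i) - g i\<bar> \<le> 1" for i
    using step[of "int i"] first by (auto simp: g_def add.commute)
  then obtain p where len: "length p = ?k" and height: "\<And>i. i \<le> ?k \<Longrightarrow> path_height p i = g i"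
    using path_with_heights[of g ?k] by (auto simp: g_def)
  have "?k \<ge> 1" using t by simp
  have "\<not> prefix [Up] p"
  proof
    assume "prefix [Up] p"
    then have "path_height p (Suc 0) = 1"
      using path_height_Suc[of 0 p] by (auto simp: prefix_Up_iff)
    then show False using height[of "Suc 0"] \<open>?k \<ge> 1\<close> first by (auto simp: g_def)
  qed
  moreover have "\<bar>2 * (\<Sum>x\<leftarrow>p. rise x) + int d + 1\<bar> \<le> 1"
  proof -
    have total: "(\<Sum>x\<leftarrow>p. rise x) = h (int ?k) - 1"
      using height[of ?k] len path_height_length[of p] \<open>?k \<ge> 1\<close> by (simp add: g_def)
    have "h (int (t - ?k)) = 1 - int d - h (int ?k)"
      using reflect[of ?k] t by simp
    moreover have "int (t - ?k) = int ?k \<or> int (t - ?k) = int ?k + 1" by linarith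
    then have "\<bar>h (int (t - ?k)) - h (int ?k)\<bar> \<le> 1"
      using step[of "int ?k"] by (elim disjE) (simp_all del: of_nat_diff)
    ultimately show ?thesis by (simp add: total)
  qed
  ultimately have p: "p \<in> half_paths t d" using len by (simp add: half_paths_def)
  have base: "unfold_path t d p (int r) = h (int r)" if r: "r < t" for r
  proof -
    consider "r = 0" | "0 < r" "r \<le> ?k" | "?k < r" by linarith
    then show ?thesis
    proof cases
      case 1
      then show ?thesis by (simp add: zero)
    next
      case 2
      then show ?thesis by (simp add: unfold_path_lower height g_def)
    next
      case 3
      then have "t - ?k \<le> r" "t - r \<le> ?k" by linarith+
      then show ?thesis
        using unfold_path_upper[OF p cop t0, of r] height[of "t - r"] reflect[of r] r 3
        by (simp add: g_def)
    qed
  qed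
  have "unfold_path t d p i = h i" for i
  proof -
    obtain r q where i: "i = int r + q * int t" and r: "r < t" using int_div_mod_nat[OF t0] .
    show ?thesis
      using base[OF r] unfold_path_shift[OF t0, of d p "int r" q]
        quasiperiodic_shift[of h, OF per, of "int r" q] by (simp add: i)
  qed
  then have "unfold_path t d p = h" by blast
  with p show ?thesis by (rule that)
qed

lemma bij_betw_unfold_path:
  assumes "coprime t d" "t \<ge> 2"
  shows "bij_betw (unfold_path t d) (half_paths t d) (height_functions t d)"
proof -
  have "p = q" if p: "p \<in> half_paths t d" and q: "q \<in> half_paths t d"
    and eq: "unfold_path t d p = unfold_path t d q" for p q
  proof (rule path_eqI)
    show "length p = length q" using p q by (simp add: half_paths_def)
    fix i assume "i \<le> length p"
    then have "i \<le> t div 2" using p by (simp add: half_paths_def)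
    then show "path_height p i = path_height q i"
      using fun_cong[OF eq, of "int i"] by (cases "i = 0") (simp_all add: unfold_path_lower)
  qed
  then have "inj_on (unfold_path t d) (half_paths t d)" by (auto intro: inj_onI)
  then show ?thesis
    unfolding bij_betw_def using unfold_path_mem[OF _ assms] height_function_unfolds[OF _ assms]
    by (metis subset_antisym image_subsetI subsetI image_eqI)
qed

section \<open>The three parities\<close>

lemma DD_cores_half_paths:
  assumes "s > 0" "d > 0" "coprime s d"
  shows "\<exists>f. bij_betw f (DD_cores s (s + d) (s + 2 * d)) (half_paths (s + d) d)"
proof -
  have cop: "coprime (s + d) d" using assms(3) unfolding coprime_iff_gcd_eq_1 by simp
  have "bij_betw (region (s + d) d \<circ> unfold_path (s + d) d) (half_paths (s + d) d) (core_sets s d)"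
    using assms cop by (intro bij_betw_trans[OF bij_betw_unfold_path bij_betw_region]) auto
  from bij_betw_trans[OF bij_betw_beads[OF assms(1,3)] bij_betw_inv_into[OF this]]
  show ?thesis by blast
qed

lemma half_paths_odd:
  assumes "odd d"
  shows "half_paths t d = restricted_motzkin_paths (t div 2) (- ((int d + 1) div 2)) {[Up]} {}"
proof -
  have "\<bar>2 * n + int d + 1\<bar> \<le> 1 \<longleftrightarrow> n = - ((int d + 1) div 2)" for n :: int
    using assms by presburger
  then show ?thesis
    by (auto simp: half_paths_def restricted_motzkin_paths_def free_motzkin_paths_def)
qed

text \<open>For even \<open>d\<close> a half path ends at \<open>- d / 2\<close> or at \<open>- d / 2 - 1\<close>. These are exactly the heights
  from which one step other than \<open>Down\<close> leads to \<open>- d / 2\<close>, and the step is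
  determined by the height.\<close>
lemma bij_betw_butlast_half_paths:
  assumes "even d" "t \<ge> 2"
  shows "bij_betw butlast
    (restricted_motzkin_paths (Suc (t div 2)) (- (int d div 2)) {[Up]} {[Down]}) (half_paths t d)"
proof -
  let ?R = "restricted_motzkin_paths (Suc (t div 2)) (- (int d div 2)) {[Up]} {[Down]}"
  define last_step where
    "last_step p = (if (\<Sum>x\<leftarrow>p. rise x) = - (int d div 2) then Flat else Up)" for p
  have k: "t div 2 \<ge> 1" using assms(2) by simp
  obtain c where d: "d = 2 * c" using assms(1) by (elim evenE)
  have snoc: "p @ [x] \<in> ?R \<longleftrightarrow> p \<in> half_paths t d \<and> x = last_step p" if "length p = t div 2" for p x
  proof -
    \<comment> \<open>The path \<open>p\<close> is nonempty, so the appended step is not the first one.\<close>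
    have "prefix [Up] (p @ [x]) \<longleftrightarrow> prefix [Up] p"
      using that k by (cases p) auto
    then show ?thesis
      using that d by (cases x)
        (auto simp: restricted_motzkin_paths_def free_motzkin_paths_def half_paths_def last_step_def)
  qed
  have decompose: "length (butlast q) = t div 2 \<and> q = butlast q @ [last q]" if "q \<in> ?R" for q
    using that by (cases q rule: rev_cases)
      (auto simp: restricted_motzkin_paths_def free_motzkin_paths_def)
  show ?thesis
  proof (rule bij_betw_byWitness[where f' = "\<lambda>p. p @ [last_step p]"])
    show "\<forall>q\<in>?R. butlast q @ [last_step (butlast q)] = q"
      using snoc decompose by metis
    show "butlast ` ?R \<subseteq> half_paths t d"
      using snoc decompose by (metis image_subsetI)
    show "(\<lambda>p. p @ [last_step p]) ` half_paths t d \<subseteq> ?R"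
      using snoc by (auto simp: half_paths_def)
  qed simp
qed

theorem theorem4p11:
  fixes s d :: nat
  assumes "s > 0" and "d > 0" and "coprime s d"
  shows
    "(odd s \<and> even d \<longrightarrow>
        (\<exists>f. bij_betw f (DD_cores s (s + d) (s + 2 * d))
           (restricted_motzkin_paths ((s + d + 1) div 2) (- (int d div 2)) {[Up]} {[Down]}))) \<and>
     (odd s \<and> odd d \<longrightarrow>
        (\<exists>f. bij_betw f (DD_cores s (s + d) (s + 2 * d))
           (restricted_motzkin_paths ((s + d) div 2) (- ((int d + 1) div 2)) {[Up]} {}))) \<and>
     (even s \<and> odd d \<longrightarrow>
        (\<exists>f. bij_betw f (DD_cores s (s + d) (s + 2 * d))
           (restricted_motzkin_paths ((s + d - 1) div 2) (- ((int d + 1) div 2)) {[Up]} {})))"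
proof -
  obtain f where f: "bij_betw f (DD_cores s (s + d) (s + 2 * d)) (half_paths (s + d) d)"
    using DD_cores_half_paths[OF assms] by blast
  have "\<exists>g. bij_betw g (DD_cores s (s + d) (s + 2 * d))
      (restricted_motzkin_paths ((s + d + 1) div 2) (- (int d div 2)) {[Up]} {[Down]})"
    if "odd s" "even d"
  proof -
    have "(s + d + 1) div 2 = Suc ((s + d) div 2)" using that by presburger
    moreover have "2 \<le> s + d" using assms by simp
    ultimately show ?thesis
      using bij_betw_trans[OF f bij_betw_inv_into[OF bij_betw_butlast_half_paths]] that by metis
  qed
  moreover have "(s + d - 1) div 2 = (s + d) div 2" if "even s" "odd d"
    using that assms by presburger
  ultimately show ?thesis using f half_paths_odd[of d "s + d"] by metis
qed

end
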